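(* Let $P$ be a poset. (i) If there is a Stone space that admits a complete trim $P$-partition, then $P$ satisfies the ascending chain condition. (ii) If $P$ is countable and there is an $\omega$-Stone space that admits a good $P$-partition, then $P$ is $\omega$-complete.
   Context: Let $(P,\le)$ be a poset and $W$ a topological space. A $P$-partition of $W$ is a family $\mathscr{X}=\{X_p\mid p\in P\}$ of pairwise disjoint non-empty subsets of $W$; write $X=\bigcup_p X_p$; $\mathscr{X}$ is complete if $X=W$. For $Y\subseteq W$ its type is $T(Y)=\{p\in P: Y\cap X_p\neq\emptyset\}$. An open set $A$ is $p$-trim (written $t(A)=p$) if $T(A)=\{q\in P:q\ge p\}$, trim if $p$-trim for some $p$; when $W$ is a Stone space, trim sets are additionally required to be compact. $\widehat{P}=\{p: W$ contains a $p$-trim set$\}$. $\mathscr{X}$ is semi-trim if: every point of $W$ has a neighbourhood base of trim sets; if $A$ is open and $p\in T(A)\cap\widehat P$ then $A$ contains a $p$-trim subset; if $x\in X_p$ then $p=\sup_P\{t(A): A\text{ trim}, x\in A\}$; and for each $p$ every point with a neighbourhood base of $p$-trim sets lies in $X_p$. A trim $P$-partition is a semi-trim one in which each $x\in X_p$ has a $p$-trim neighbourhood. A good $P$-partition is a complete $P$-partition with $\overline{X_p}=\bigcup_{q\le p}X_q$ for all $p$. A Stone space is the Stone space of a Boolean ring; an $\omega$-Stone space is that of a countable Boolean ring. $P$ satisfies the ascending chain condition if it has no strictly increasing sequence $p_1<p_2<\cdots$; it is $\omega$-complete if every ascending sequence $p_1\le p_2\le\cdots$ has a supremum. *)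

theory Defs
  imports "HOL-Analysis.Analysis" "HOL-Library.Lub_Glb"
begin

section \<open>Stone spaces of Boolean rings\<close>

text \<open>Boolean rings need not have an identity, so their Stone spaces are locally compact
  but not necessarily compact.\<close>

class boolean_ring = ring +
  assumes mult_idem: "x * x = x"

definition prime_ideal :: "'r::boolean_ring set \<Rightarrow> bool" where
  "prime_ideal I \<longleftrightarrow>
     0 \<in> I \<and> (\<forall>a\<in>I. \<forall>b\<in>I. a - b \<in> I) \<and> (\<forall>a\<in>I. \<forall>r. r * a \<in> I \<and> a * r \<in> I) \<and>
     I \<noteq> UNIV \<and> (\<forall>a b. a * b \<in> I \<longrightarrow> a \<in> I \<or> b \<in> I)"

text \<open>The basic open sets below are closed under binary intersections and are exactly the
  compact open sets of the Stone space.\<close>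

definition stone_topology :: "'r::boolean_ring set topology" where
  "stone_topology = topology_generated_by (range (\<lambda>a. {I. prime_ideal I \<and> a \<notin> I}))"

lemma topspace_stone_topology: "topspace stone_topology = Collect prime_ideal"
  by (auto simp: stone_topology_def topology_generated_by_topspace prime_ideal_def)

text \<open>The argument of type \<open>'r itself\<close> names the type carrying the Boolean ring.\<close>

definition Stone_space :: "'r::boolean_ring itself \<Rightarrow> 'w topology \<Rightarrow> bool" where
  "Stone_space R W \<longleftrightarrow> W homeomorphic_space (stone_topology :: 'r set topology)"

definition omega_Stone_space :: "'r::boolean_ring itself \<Rightarrow> 'w topology \<Rightarrow> bool" where
  "omega_Stone_space R W \<longleftrightarrow> countable (UNIV :: 'r set) \<and> Stone_space R W"


section \<open>Partitions indexed by a poset\<close>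

text \<open>The poset is a set \<open>P\<close> with the order inherited from its type; it may be empty.
  Only the values of the family \<open>X\<close> on \<open>P\<close> matter.\<close>

definition P_partition :: "'p::order set \<Rightarrow> 'w topology \<Rightarrow> ('p \<Rightarrow> 'w set) \<Rightarrow> bool" where
  "P_partition P W X \<longleftrightarrow>
     (\<forall>p\<in>P. X p \<noteq> {} \<and> X p \<subseteq> topspace W) \<and> disjoint_family_on X P"

definition complete_P_partition :: "'p::order set \<Rightarrow> 'w topology \<Rightarrow> ('p \<Rightarrow> 'w set) \<Rightarrow> bool" where
  "complete_P_partition P W X \<longleftrightarrow> P_partition P W X \<and> (\<Union>p\<in>P. X p) = topspace W"

definition type_of :: "'p::order set \<Rightarrow> ('p \<Rightarrow> 'w set) \<Rightarrow> 'w set \<Rightarrow> 'p set" where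
  "type_of P X Y = {p\<in>P. Y \<inter> X p \<noteq> {}}"

text \<open>This is the notion of trim set for Stone spaces, where trim sets are required to be
  compact; \<open>p_trim\<close>, and the notions built on it, are only meant for Stone spaces \<open>W\<close>.\<close>

definition p_trim ::
  "'p::order set \<Rightarrow> 'w topology \<Rightarrow> ('p \<Rightarrow> 'w set) \<Rightarrow> 'p \<Rightarrow> 'w set \<Rightarrow> bool" where
  "p_trim P W X p A \<longleftrightarrow>
     p \<in> P \<and> openin W A \<and> compactin W A \<and> type_of P X A = {q\<in>P. p \<le> q}"

definition trim :: "'p::order set \<Rightarrow> 'w topology \<Rightarrow> ('p \<Rightarrow> 'w set) \<Rightarrow> 'w set \<Rightarrow> bool" where
  "trim P W X A \<longleftrightarrow> (\<exists>p. p_trim P W X p A)"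

definition P_hat :: "'p::order set \<Rightarrow> 'w topology \<Rightarrow> ('p \<Rightarrow> 'w set) \<Rightarrow> 'p set" where
  "P_hat P W X = {p\<in>P. \<exists>A. p_trim P W X p A}"

definition has_nbhd_base :: "'w topology \<Rightarrow> ('w set \<Rightarrow> bool) \<Rightarrow> 'w \<Rightarrow> bool" where
  "has_nbhd_base W Q x \<longleftrightarrow> (\<forall>U. openin W U \<and> x \<in> U \<longrightarrow> (\<exists>A. Q A \<and> x \<in> A \<and> A \<subseteq> U))"

text \<open>A trim set is \<open>q\<close>-trim for exactly one \<open>q\<close>, so the set of types \<open>t(A)\<close> of the trim
  sets \<open>A\<close> containing \<open>x\<close> is \<open>{q. \<exists>A. p_trim P W X q A \<and> x \<in> A}\<close>.\<close>

definition semi_trim_P_partition :: "'p::order set \<Rightarrow> 'w topology \<Rightarrow> ('p \<Rightarrow> 'w set) \<Rightarrow> bool" where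
  "semi_trim_P_partition P W X \<longleftrightarrow>
     P_partition P W X \<and>
     (\<forall>x\<in>topspace W. has_nbhd_base W (trim P W X) x) \<and>
     (\<forall>A. openin W A \<longrightarrow>
        (\<forall>p \<in> type_of P X A \<inter> P_hat P W X. \<exists>B\<subseteq>A. p_trim P W X p B)) \<and>
     (\<forall>p\<in>P. \<forall>x\<in>X p. isLub P {q. \<exists>A. p_trim P W X q A \<and> x \<in> A} p) \<and>
     (\<forall>p\<in>P. \<forall>x\<in>topspace W. has_nbhd_base W (p_trim P W X p) x \<longrightarrow> x \<in> X p)"

definition trim_P_partition :: "'p::order set \<Rightarrow> 'w topology \<Rightarrow> ('p \<Rightarrow> 'w set) \<Rightarrow> bool" where
  "trim_P_partition P W X \<longleftrightarrow>
     semi_trim_P_partition P W X \<and> (\<forall>p\<in>P. \<forall>x\<in>X p. \<exists>A. p_trim P W X p A \<and> x \<in> A)"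

definition good_P_partition :: "'p::order set \<Rightarrow> 'w topology \<Rightarrow> ('p \<Rightarrow> 'w set) \<Rightarrow> bool" where
  "good_P_partition P W X \<longleftrightarrow>
     complete_P_partition P W X \<and> (\<forall>p\<in>P. W closure_of X p = (\<Union>q\<in>{q\<in>P. q \<le> p}. X q))"


section \<open>Chain conditions on posets\<close>

definition ascending_chain_condition :: "'p::order set \<Rightarrow> bool" where
  "ascending_chain_condition P \<longleftrightarrow> \<not> (\<exists>f :: nat \<Rightarrow> 'p. range f \<subseteq> P \<and> strict_mono f)"

definition omega_complete :: "'p::order set \<Rightarrow> bool" where
  "omega_complete P \<longleftrightarrow>
     (\<forall>f :: nat \<Rightarrow> 'p. range f \<subseteq> P \<and> mono f \<longrightarrow> (\<exists>s. isLub P (range f) s))"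

end

theory Submission
  imports Defs
begin

text \<open>
  Both parts rest on Stone spaces being locally compact and Hausdorff.

  (i) Along a chain \<open>p\<^sub>0 < p\<^sub>1 < \<dots>\<close> choose nested \<open>p\<^sub>n\<close>-trim sets \<open>A\<^sub>n\<close> and points
  \<open>x\<^sub>n\<close> of \<open>A\<^sub>n\<close> in \<open>X\<^bsub>p\<^sub>n\<^esub>\<close>. By compactness the sequence has a cluster point \<open>x\<close>,
  in \<open>X\<^sub>q\<close> say. As \<open>x\<close> lies in every \<open>A\<^sub>n\<close>, \<open>q\<close> is above every \<open>p\<^sub>n\<close>; as every \<open>q\<close>-trim
  neighbourhood of \<open>x\<close> contains some \<open>x\<^sub>n\<close>, also \<open>q \<le> p\<^sub>n\<close> for some \<open>n\<close>.

  (ii) Let \<open>F\<close> be the closure of the union of the \<open>X\<^bsub>p\<^sub>n\<^esub>\<close>. Any \<open>q\<close> such that \<open>X\<^sub>q\<close> meets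
  \<open>F\<close> is below all upper bounds of the chain. For each of the countably many \<open>r\<close> that are not
  upper bounds, \<open>F\<close> minus the closure of \<open>X\<^sub>r\<close> is open and dense in \<open>F\<close>, so by Baire's
  theorem some point of \<open>F\<close> lies in an \<open>X\<^sub>q\<close> with \<open>q\<close> an upper bound.
\<close>

section \<open>Stone spaces are locally compact and Hausdorff\<close>

lemma openin_stone_basic:
  "openin stone_topology {I. prime_ideal I \<and> (a::'r::boolean_ring) \<notin> I}"
  unfolding stone_topology_def by (rule topology_generated_by_Basis) auto

text \<open>Take \<open>a\<close> in \<open>I\<close> but not in \<open>J\<close>, and
  \<open>b\<close> outside \<open>I\<close>. Without an identity, \<open>b - b * a\<close> stands in
  for \<open>1 - a\<close>: its product with \<open>a\<close> is zero, so no prime ideal avoids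
  both.\<close>

lemma Hausdorff_stone_topology:
  "Hausdorff_space (stone_topology :: 'r::boolean_ring set topology)"
proof -
  have sep: "\<exists>U V. openin stone_topology U \<and> openin stone_topology V \<and> I \<in> U \<and> J \<in> V \<and> disjnt U V"
    if I: "prime_ideal I" and J: "prime_ideal J" and a: "a \<in> I" "a \<notin> J"
    for I J :: "'r set" and a
  proof -
    obtain b where b: "b \<notin> I"
      using I by (auto simp: prime_ideal_def)
    have "b * a \<in> I"
      using I a by (auto simp: prime_ideal_def)
    \<comment> \<open>Here \<open>b\<close> is recovered as
      \<open>(b - b * a) - (0 - b * a)\<close>, since the ideal axioms provide closure under
      differences.\<close>
    moreover have "b - 0 \<in> I" if "b - b * a \<in> I" "b * a \<in> I"
    proof -
      have "0 - b * a \<in> I" "\<And>x y. x \<in> I \<Longrightarrow> y \<in> I \<Longrightarrow> x - y \<in> I"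
        using I that by (auto simp: prime_ideal_def)
      from this(2)[OF that(1) this(1)] show ?thesis by simp
    qed
    ultimately have c: "b - b * a \<notin> I"
      using b by auto
    have "(b - b * a) * a = 0"
      by (simp add: left_diff_distrib mult.assoc mult_idem)
    then have "a \<in> K \<or> b - b * a \<in> K" if "prime_ideal K" for K
      using that unfolding prime_ideal_def by metis
    then have "disjnt {K. prime_ideal K \<and> b - b * a \<notin> K} {K. prime_ideal K \<and> a \<notin> K}"
      by (auto simp: disjnt_def)
    then show ?thesis
      using openin_stone_basic I J a c by (intro exI conjI) auto
  qed
  show ?thesis
    unfolding Hausdorff_space_def topspace_stone_topology
  proof (intro allI impI, elim conjE)
    fix I J :: "'r set"
    assume *: "I \<in> Collect prime_ideal" "J \<in> Collect prime_ideal" "I \<noteq> J"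
    then consider a where "a \<in> I" "a \<notin> J" | a where "a \<in> J" "a \<notin> I" by auto
    then show "\<exists>U V. openin stone_topology U \<and> openin stone_topology V \<and> I \<in> U \<and> J \<in> V \<and> disjnt U V"
    proof cases
      case 1
      with * sep show ?thesis by blast
    next
      case 2
      with * sep[of J I a] obtain U V where "openin stone_topology U" "openin stone_topology V"
        "J \<in> U" "I \<in> V" "disjnt U V" by auto
      then show ?thesis by (intro exI[of _ V] exI[of _ U]) (simp add: disjnt_sym)
    qed
  qed
qed

text \<open>The prime ideals avoiding \<open>a\<close> are a closed subset of the product space \<open>2\<^sup>R\<close>.\<close>

lemma compactin_stone_basic:
  "compactin stone_topology {I. prime_ideal I \<and> (a::'r::boolean_ring) \<notin> I}"
proof -
  define K where "K = {f :: 'r \<Rightarrow> bool. prime_ideal (Collect f) \<and> \<not> f a}"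
  have cont: "continuous_on UNIV (\<lambda>f :: 'r \<Rightarrow> bool. f x)" for x
    by simp
  have op: "open {f :: 'r \<Rightarrow> bool. f x}" for x
    using open_vimage[OF open_discrete[of "{True}"] cont[of x]] by (simp add: vimage_def)
  have ncl: "open {f :: 'r \<Rightarrow> bool. \<not> f x}" for x
    using open_vimage[OF open_discrete[of "{False}"] cont[of x]] by (simp add: vimage_def)
  have cl: "closed {f :: 'r \<Rightarrow> bool. f x}" for x
    using closed_Collect_neg[OF ncl[of x]] by simp
  \<comment> \<open>For fixed elements each clause constrains finitely many coordinates. Fixing
    \<open>a\<close> as the witness of properness turns an open condition into a closed one.\<close>
  have K: "K = {f. f 0 \<and> (\<forall>x y. f x \<longrightarrow> f y \<longrightarrow> f (x - y)) \<and>
      (\<forall>x r. f x \<longrightarrow> f (r * x) \<and> f (x * r)) \<and> (\<forall>x y. f (x * y) \<longrightarrow> f x \<or> f y) \<and> \<not> f a}"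
    unfolding K_def prime_ideal_def by auto
  have "closed K"
    unfolding K
    by (intro closed_Collect_conj closed_Collect_all closed_Collect_imp closed_Collect_disj
        closed_Collect_neg cl op)
  moreover have "compact (UNIV :: ('r \<Rightarrow> bool) set)"
  proof -
    have "compact_space (euclidean :: bool topology)"
      by (simp add: compact_space_def finite_imp_compact)
    then have "compact_space (product_topology (\<lambda>i::'r. euclidean :: bool topology) UNIV)"
      by (simp add: compact_space_product_topology)
    then show ?thesis
      by (simp add: euclidean_product_topology compact_space_def)
  qed
  ultimately have "compact K"
    using compact_Int_closed[of UNIV K] by simp
  then have "compactin (top_of_set K) K"
    by (simp add: compactin_subtopology)
  moreover have "continuous_map (top_of_set K) stone_topology Collect"
    unfolding stone_topology_def
  proof (rule continuous_on_generated_topo)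
    fix U assume "U \<in> range (\<lambda>a::'r. {I. prime_ideal I \<and> a \<notin> I})"
    then obtain b where "U = {I. prime_ideal I \<and> b \<notin> I}" by auto
    then have "Collect -` U \<inter> topspace (top_of_set K) = K \<inter> {f. \<not> f b}"
      by (auto simp: K_def)
    with ncl[of b] show "openin (top_of_set K) (Collect -` U \<inter> topspace (top_of_set K))"
      by (auto simp: openin_open)
  qed (auto simp: K_def)
  ultimately have "compactin stone_topology (Collect ` K)"
    by (rule image_compactin)
  moreover have "Collect ` K = {I. prime_ideal I \<and> a \<notin> I}"
  proof (intro equalityI subsetI)
    fix I assume "I \<in> {I. prime_ideal I \<and> a \<notin> I}"
    then have "(\<lambda>x. x \<in> I) \<in> K" by (simp add: K_def)
    then have "Collect (\<lambda>x. x \<in> I) \<in> Collect ` K" by (rule imageI)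
    then show "I \<in> Collect ` K" by simp
  qed (auto simp: K_def)
  ultimately show ?thesis by simp
qed

lemma locally_compact_stone_topology:
  "locally_compact_space (stone_topology :: 'r::boolean_ring set topology)"
  unfolding locally_compact_space_def topspace_stone_topology
proof
  fix I :: "'r set" assume "I \<in> Collect prime_ideal"
  moreover then obtain a where "a \<notin> I" by (auto simp: prime_ideal_def)
  ultimately show "\<exists>U K. openin stone_topology U \<and> compactin stone_topology K \<and> I \<in> U \<and> U \<subseteq> K"
    using openin_stone_basic[of a] compactin_stone_basic[of a] by blast
qed

lemma Stone_space_Hausdorff: "Stone_space TYPE('r::boolean_ring) W \<Longrightarrow> Hausdorff_space W"
  using Hausdorff_stone_topology homeomorphic_Hausdorff_space
  unfolding Stone_space_def by blast

lemma Stone_space_locally_compact: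
  "Stone_space TYPE('r::boolean_ring) W \<Longrightarrow> locally_compact_space W"
  using locally_compact_stone_topology homeomorphic_locally_compact_space
  unfolding Stone_space_def by blast

section \<open>Partitions of Hausdorff spaces\<close>

lemma trim_P_partition_imp_ascending_chain_condition:
  fixes P :: "'p::order set"
  assumes haus: "Hausdorff_space W"
    and comp: "complete_P_partition P W X" and trim: "trim_P_partition P W X"
  shows "ascending_chain_condition P"
  unfolding ascending_chain_condition_def
proof
  assume "\<exists>f :: nat \<Rightarrow> 'p. range f \<subseteq> P \<and> strict_mono f"
  then obtain f :: "nat \<Rightarrow> 'p" where fP: "\<And>n. f n \<in> P" and f: "strict_mono f" by auto
  have nonempty: "\<And>p. p \<in> P \<Longrightarrow> X p \<noteq> {}" and cover: "(\<Union>p\<in>P. X p) = topspace W"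
    using comp by (auto simp: complete_P_partition_def P_partition_def)
  have semi: "\<exists>B\<subseteq>A. p_trim P W X p B"
    if "openin W A" "p \<in> type_of P X A" "p \<in> P_hat P W X" for A p
    using trim that by (auto simp: trim_P_partition_def semi_trim_P_partition_def)
  have point: "\<exists>A. p_trim P W X p A \<and> x \<in> A" if "p \<in> P" "x \<in> X p" for p x
    using trim that by (auto simp: trim_P_partition_def)
  \<comment> \<open>Each \<open>X p\<close> has a point, and that point has a \<open>p\<close>-trim
    neighbourhood.\<close>
  have hat: "p \<in> P_hat P W X" if "p \<in> P" for p
    using nonempty[OF that] point[OF that] that by (fastforce simp: P_hat_def)
  have "\<exists>A. \<forall>n. p_trim P W X (f n) (A n) \<and> A (Suc n) \<subseteq> A n"
  proof (rule dependent_nat_choice)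
    show "\<exists>A. p_trim P W X (f 0) A"
      using hat[OF fP] by (auto simp: P_hat_def)
  next
    fix A n assume A: "p_trim P W X (f n) A"
    \<comment> \<open>The type of \<open>A\<close> is everything in \<open>P\<close> above
      \<open>f n\<close>, so \<open>A\<close> meets \<open>X (f (Suc n))\<close> and can be shrunk
      by semi-trimness.\<close>
    have "f n \<le> f (Suc n)"
      using f by (simp add: strict_mono_less_eq)
    then have "f (Suc n) \<in> type_of P X A"
      using A fP by (auto simp: p_trim_def)
    then show "\<exists>B. p_trim P W X (f (Suc n)) B \<and> B \<subseteq> A"
      using semi[of A "f (Suc n)"] A hat[OF fP] by (auto simp: p_trim_def)
  qed
  then obtain A where A: "\<And>n. p_trim P W X (f n) (A n)" and Suc: "\<And>n. A (Suc n) \<subseteq> A n"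
    by auto
  have dec: "A n \<subseteq> A m" if "m \<le> n" for m n
    by (rule lift_Suc_antimono_le[of A, OF Suc that])
  have Acl: "closedin W (A n)" and Acpt: "compactin W (A n)" for n
    using A[of n] haus compactin_imp_closedin by (auto simp: p_trim_def)
  have "\<forall>n. \<exists>x. x \<in> A n \<inter> X (f n)"
  proof
    fix n
    have "f n \<in> type_of P X (A n)" using A[of n] fP by (simp add: p_trim_def)
    then show "\<exists>x. x \<in> A n \<inter> X (f n)" by (auto simp: type_of_def)
  qed
  then obtain x where x: "\<And>n. x n \<in> A n" "\<And>n. x n \<in> X (f n)" by (auto simp: choice_iff)
  \<comment> \<open>Closures of the tails: their intersection is the set of cluster points, nonempty
    because all of them lie in the compact set \<open>A 0\<close>.\<close>
  define C where "C n = W closure_of (x ` {n..})" for n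
  have CA: "C n \<subseteq> A n" for n
    unfolding C_def using x(1) dec by (intro closure_of_minimal Acl) blast
  have xW: "x n \<in> topspace W" for n
    using x(1) Acpt compactin_subset_topspace by blast
  have "(\<Inter>n. C n) \<noteq> {}"
  proof (rule compact_space_imp_nest)
    show "compact_space (subtopology W (A 0))"
      using Acpt by (simp add: compact_space_subtopology)
    show "closedin (subtopology W (A 0)) (C n)" for n
      using CA[of n] dec[of 0 n] by (intro closedin_subset_topspace) (auto simp: C_def)
    show "C n \<noteq> {}" for n
    proof -
      have "x ` {n..} \<subseteq> C n"
        unfolding C_def by (rule closure_of_subset) (use xW in auto)
      then show ?thesis by auto
    qed
    show "decseq C"
      unfolding decseq_def C_def by (intro allI impI closure_of_mono image_mono) auto
  qed
  then obtain y where y: "\<And>n. y \<in> C n" by auto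
  then have yA: "y \<in> A n" for n using CA by blast
  then have "y \<in> topspace W" using Acpt compactin_subset_topspace by blast
  then obtain q where q: "q \<in> P" "y \<in> X q" using cover by auto
  obtain B where B: "p_trim P W X q B" "y \<in> B" using point[OF q] by auto
  then have "openin W B" by (simp add: p_trim_def)
  moreover have "y \<in> W closure_of (range x)" using y[of 0] by (simp add: C_def atLeast_0)
  ultimately obtain n where "x n \<in> B"
    using B(2) by (auto simp: in_closure_of)
  then have "f n \<in> type_of P X B" using fP x(2) by (auto simp: type_of_def)
  then have "q \<le> f n" using B(1) by (auto simp: p_trim_def)
  \<comment> \<open>The index \<open>Suc n\<close> gives the strict step:
    \<open>q \<le> f n < f (Suc n) \<le> q\<close>.\<close>
  moreover have "q \<in> type_of P X (A (Suc n))" using q yA by (auto simp: type_of_def)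
  then have "f (Suc n) \<le> q" using A[of "Suc n"] by (auto simp: p_trim_def)
  moreover have "f n < f (Suc n)" using f by (simp add: strict_mono_less)
  ultimately show False by (meson leD order_trans)
qed

lemma good_P_partition_imp_omega_complete:
  fixes P :: "'p::order set"
  assumes haus: "Hausdorff_space W" and loc: "locally_compact_space W"
    and count: "countable P" and good: "good_P_partition P W X"
  shows "omega_complete P"
  unfolding omega_complete_def
proof (intro allI impI)
  fix f :: "nat \<Rightarrow> 'p" assume f: "range f \<subseteq> P \<and> mono f"
  then have fP: "\<And>n. f n \<in> P" and mono: "mono f" by auto
  have nonempty: "\<And>p. p \<in> P \<Longrightarrow> X p \<noteq> {}" and sub: "\<And>p. p \<in> P \<Longrightarrow> X p \<subseteq> topspace W"
    and disj: "disjoint_family_on X P" and cover: "(\<Union>p\<in>P. X p) = topspace W"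
    and cl: "\<And>p. p \<in> P \<Longrightarrow> W closure_of X p = (\<Union>q\<in>{q\<in>P. q \<le> p}. X q)"
    using good unfolding good_P_partition_def complete_P_partition_def P_partition_def
    by simp_all
  \<comment> \<open>By disjointness \<open>q\<close> is the only index whose class contains
    \<open>x\<close>, so membership in closures decides the order.\<close>
  have mem_cl: "x \<in> W closure_of X p \<longleftrightarrow> q \<le> p" if "p \<in> P" "q \<in> P" "x \<in> X q" for p q x
  proof -
    have "r = q" if "r \<in> P" "x \<in> X r" for r
      using that \<open>q \<in> P\<close> \<open>x \<in> X q\<close> disj by (auto simp: disjoint_family_on_def)
    then show ?thesis
      using that unfolding cl[OF that(1)] by blast
  qed
  define F where "F = W closure_of (\<Union>n. X (f n))"
  define S where "S = subtopology W F"
  have "(\<Union>n. X (f n)) \<subseteq> F"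
    unfolding F_def by (rule closure_of_subset) (use sub fP in auto)
  then have subF: "X (f n) \<subseteq> F" for n by auto
  have FW: "F \<subseteq> topspace W" by (simp add: F_def closure_of_subset_topspace)
  then have topS: "topspace S = F" by (auto simp: S_def)
  define G where "G r = F - W closure_of X r" for r
  define R where "R = {r\<in>P. \<exists>n. \<not> f n \<le> r}"
  \<comment> \<open>Baire's theorem is applied inside \<open>F\<close>, a closed and hence locally
    compact subspace, because the sets \<open>G r\<close> are dense in \<open>F\<close> but perhaps
    not in \<open>W\<close>.\<close>
  have "S closure_of \<Inter>(G ` R) = topspace S"
  proof (rule Baire_category)
    have "locally_compact_space S"
      unfolding S_def by (rule locally_compact_space_closed_subset[OF loc]) (simp add: F_def)
    moreover have "Hausdorff_space S"
      unfolding S_def by (rule Hausdorff_space_subtopology[OF haus])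
    ultimately show "completely_metrizable_space S \<or> locally_compact_space S \<and> regular_space S"
      using locally_compact_Hausdorff_imp_regular_space by blast
    show "countable (G ` R)"
      using count by (intro countable_image countable_subset[of R P]) (auto simp: R_def)
  next
    fix T assume "T \<in> G ` R"
    then obtain r m where T: "T = G r" and r: "r \<in> P" and m: "\<not> f m \<le> r"
      by (auto simp: R_def)
    have "openin S T"
      unfolding S_def openin_subtopology T G_def
      by (intro exI[of _ "topspace W - W closure_of X r"]) (use FW in \<open>auto intro: openin_diff\<close>)
    moreover have "S closure_of T = topspace S"
      unfolding dense_intersects_open
    proof (intro allI impI, elim conjE)
      fix V assume "openin S V" "V \<noteq> {}"
      then obtain U where U: "openin W U" and V: "V = U \<inter> F"
        by (auto simp: S_def openin_subtopology)
      have "U \<inter> (\<Union>n. X (f n)) \<noteq> {}"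
        using \<open>V \<noteq> {}\<close> openin_Int_closure_of_eq_empty[OF U] unfolding V F_def by blast
      then obtain n where n: "U \<inter> X (f n) \<noteq> {}" by blast
      \<comment> \<open>The index moves up to \<open>max m n\<close>: \<open>U\<close> still meets
        that class, since its closure contains \<open>X (f n)\<close>, and being above
        \<open>f m\<close> keeps \<open>f (max m n)\<close> from lying below
        \<open>r\<close>.\<close>
      have "f n \<le> f (max m n)" using mono by (simp add: monoD)
      then have "X (f n) \<subseteq> W closure_of X (f (max m n))"
        using mem_cl[OF fP fP] by blast
      with n have "U \<inter> X (f (max m n)) \<noteq> {}"
        using openin_Int_closure_of_eq_empty[OF U] by blast
      then obtain y where y: "y \<in> U" "y \<in> X (f (max m n))" by blast
      have "f m \<le> f (max m n)" using mono by (simp add: monoD)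
      with m have "\<not> f (max m n) \<le> r" by (meson order_trans)
      then have "y \<in> T"
        using y subF mem_cl[OF r fP y(2)] by (auto simp: T G_def)
      then show "T \<inter> V \<noteq> {}" using y V subF by blast
    qed
    ultimately show "openin S T \<and> S closure_of T = topspace S" ..
  qed
  moreover have "F \<noteq> {}" using nonempty[OF fP[of 0]] subF[of 0] by blast
  \<comment> \<open>Intersecting with \<open>F\<close> covers the case of empty \<open>R\<close>,
    where the intersection over \<open>R\<close> is \<open>UNIV\<close>.\<close>
  ultimately have "F \<inter> \<Inter>(G ` R) \<noteq> {}"
    using closure_of_restrict[of S "\<Inter>(G ` R)"] unfolding topS by force
  then obtain y where yF: "y \<in> F" and yG: "\<And>r. r \<in> R \<Longrightarrow> y \<in> G r" by auto
  with FW cover obtain q where q: "q \<in> P" "y \<in> X q" by blast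
  \<comment> \<open>Otherwise the choice \<open>r = q\<close> would put \<open>y\<close> outside the
    closure of its own class.\<close>
  have "q \<notin> R"
  proof
    assume "q \<in> R"
    then have "y \<notin> W closure_of X q" using yG by (auto simp: G_def)
    then show False using mem_cl[OF q(1) q] by simp
  qed
  then have ub: "f n \<le> q" for n using q(1) by (auto simp: R_def)
  have least: "q \<le> s" if "s \<in> P" "\<And>n. f n \<le> s" for s
  proof -
    have "(\<Union>n. X (f n)) \<subseteq> W closure_of X s"
      using mem_cl[OF that(1) fP] that(2) by blast
    then have "F \<subseteq> W closure_of X s"
      unfolding F_def by (rule closure_of_minimal) simp
    then show ?thesis using yF mem_cl[OF that(1) q] by blast
  qed
  have "isLub P (range f) q"
    using q(1) ub least
    by (auto simp: isLub_def leastP_def isUb_def setle_def setge_def)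
  then show "\<exists>s. isLub P (range f) s" ..
qed

theorem theorem2p14:
  fixes P :: "'p::order set"
  shows "((\<exists>W :: 'w topology. Stone_space TYPE('r::boolean_ring) W \<and>
             (\<exists>X. complete_P_partition P W X \<and> trim_P_partition P W X))
           \<longrightarrow> ascending_chain_condition P)
       \<and> (countable P \<and>
           (\<exists>W :: 'w topology. omega_Stone_space TYPE('r::boolean_ring) W \<and>
             (\<exists>X. good_P_partition P W X))
           \<longrightarrow> omega_complete P)"
proof (intro conjI impI; elim conjE exE)
  fix W :: "'w topology" and X
  assume "Stone_space TYPE('r) W" "complete_P_partition P W X" "trim_P_partition P W X"
  then show "ascending_chain_condition P"
    by (intro trim_P_partition_imp_ascending_chain_condition[OF Stone_space_Hausdorff])
next
  fix W :: "'w topology" and X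
  assume "countable P" "omega_Stone_space TYPE('r) W" "good_P_partition P W X"
  then show "omega_complete P"
    unfolding omega_Stone_space_def
    by (intro good_P_partition_imp_omega_complete
        [OF Stone_space_Hausdorff Stone_space_locally_compact]) auto
qed

end
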